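(* There is a polynomial-time $1.5$-approximation algorithm for the Maximum Edge 2-Coloring problem on subcubic graphs; that is, there is a polynomial-time algorithm that, given any subcubic graph $G$, outputs an edge 2-coloring of $G$ using at least $\mathsf{opt}(G)/1.5$ colors.
   Context: All graphs are finite, simple and undirected. An edge 2-coloring of a graph $G$ is a map $\chi\colon E(G)\to\mathbb{N}$ such that for every vertex $v$, the set of colors $\{\chi(e) : e \text{ incident to } v\}$ has at most $2$ elements. The number of colors of $\chi$ is $|\chi| = |\{\chi(e): e\in E(G)\}|$, and $\mathsf{opt}(G)$ denotes the maximum of $|\chi|$ over all edge 2-colorings $\chi$ of $G$. The Maximum Edge 2-Coloring problem asks, given $G$, for an edge 2-coloring with the maximum number of colors. A graph is subcubic if every vertex has degree at most $3$. *)

theory Defs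
  imports Complex_Main "HOL-Computational_Algebra.Polynomial"
begin

section \<open>Edge 2-colorings of finite simple graphs\<close>

definition simple_graph :: "'a set \<Rightarrow> 'a set set \<Rightarrow> bool" where
  "simple_graph V E \<longleftrightarrow> finite V \<and> (\<forall>e\<in>E. e \<subseteq> V \<and> card e = 2)"

definition incident_edges :: "'a set set \<Rightarrow> 'a \<Rightarrow> 'a set set" where
  "incident_edges E v = {e \<in> E. v \<in> e}"

definition subcubic :: "'a set \<Rightarrow> 'a set set \<Rightarrow> bool" where
  "subcubic V E \<longleftrightarrow> (\<forall>v\<in>V. card (incident_edges E v) \<le> 3)"

text \<open>Colorings are total functions; only their values on \<open>E\<close> matter.\<close>

definition edge_2_coloring :: "'a set \<Rightarrow> 'a set set \<Rightarrow> ('a set \<Rightarrow> nat) \<Rightarrow> bool" where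
  "edge_2_coloring V E \<chi> \<longleftrightarrow> (\<forall>v\<in>V. card (\<chi> ` incident_edges E v) \<le> 2)"

definition num_colors :: "'a set set \<Rightarrow> ('a set \<Rightarrow> nat) \<Rightarrow> nat" where
  "num_colors E \<chi> = card (\<chi> ` E)"

definition opt :: "'a set \<Rightarrow> 'a set set \<Rightarrow> nat" where
  "opt V E = Max {num_colors E \<chi> | \<chi>. edge_2_coloring V E \<chi>}"

text \<open>The maximum defining \<open>opt\<close> is taken over a finite nonempty set.\<close>

lemma simple_graph_finite_edges: "simple_graph V E \<Longrightarrow> finite E"
  unfolding simple_graph_def by (rule finite_subset[of E "Pow V"]) auto

lemma finite_num_colors:
  assumes "simple_graph V E"
  shows "finite {num_colors E \<chi> | \<chi>. edge_2_coloring V E \<chi>}"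
proof (rule finite_subset)
  show "{num_colors E \<chi> | \<chi>. edge_2_coloring V E \<chi>} \<subseteq> {..card E}"
    using simple_graph_finite_edges[OF assms] by (auto simp: num_colors_def card_image_le)
qed simp

lemma edge_2_coloring_const: "edge_2_coloring V E (\<lambda>_. c)"
proof -
  have "card ((\<lambda>_. c) ` A) \<le> 2" for A :: "'a set set"
    by (cases "A = {}") (simp_all add: image_constant_conv)
  then show ?thesis
    by (simp add: edge_2_coloring_def)
qed

lemma num_colors_nonempty: "{num_colors E \<chi> | \<chi>. edge_2_coloring V E \<chi>} \<noteq> {}"
  using edge_2_coloring_const by blast


section \<open>Random access machine programs and their running time\<close>

text \<open>
  The machine model is a random access machine with structured control flow. The memory
  consists of named, unbounded arrays of natural numbers; a program mentions only finitely
  many names, and a plain register is an array used at index 0 only.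
  Every operation has unit cost. The arithmetic operations are addition and truncated
  subtraction, as in the machines of Cook and Reckhow; there is no multiplication, so the
  bit length of the numbers grows only linearly with the running time, and polynomial
  time in this model coincides with polynomial time on Turing machines.
\<close>

type_synonym memory = "string \<Rightarrow> nat \<Rightarrow> nat"

datatype expr =
    Const nat
  | Read string expr
  | Add expr expr
  | Sub expr expr

fun eval_expr :: "expr \<Rightarrow> memory \<Rightarrow> nat" where
  "eval_expr (Const k) s = k"
| "eval_expr (Read a e) s = s a (eval_expr e s)"
| "eval_expr (Add e1 e2) s = eval_expr e1 s + eval_expr e2 s"
| "eval_expr (Sub e1 e2) s = eval_expr e1 s - eval_expr e2 s"

fun expr_cost :: "expr \<Rightarrow> nat" where
  "expr_cost (Const k) = 1"
| "expr_cost (Read a e) = expr_cost e + 1"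
| "expr_cost (Add e1 e2) = expr_cost e1 + expr_cost e2 + 1"
| "expr_cost (Sub e1 e2) = expr_cost e1 + expr_cost e2 + 1"

datatype prog =
    Skip
  | Write string expr expr
  | Seq prog prog
  | IfNZ expr prog prog
  | WhileNZ expr prog

text \<open>\<open>runs c s t s'\<close>: started in memory \<open>s\<close>, program \<open>c\<close> halts after time \<open>t\<close> in memory \<open>s'\<close>.\<close>

inductive runs :: "prog \<Rightarrow> memory \<Rightarrow> nat \<Rightarrow> memory \<Rightarrow> bool" where
  Skip: "runs Skip s 1 s"
| Write: "runs (Write a i e) s (expr_cost i + expr_cost e + 1)
            (s(a := (s a)(eval_expr i s := eval_expr e s)))"
| Seq: "runs c1 s t1 s1 \<Longrightarrow> runs c2 s1 t2 s2 \<Longrightarrow> runs (Seq c1 c2) s (t1 + t2) s2"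
| IfTrue: "eval_expr b s \<noteq> 0 \<Longrightarrow> runs c1 s t s' \<Longrightarrow>
    runs (IfNZ b c1 c2) s (expr_cost b + 1 + t) s'"
| IfFalse: "eval_expr b s = 0 \<Longrightarrow> runs c2 s t s' \<Longrightarrow>
    runs (IfNZ b c1 c2) s (expr_cost b + 1 + t) s'"
| WhileFalse: "eval_expr b s = 0 \<Longrightarrow> runs (WhileNZ b c) s (expr_cost b + 1) s"
| WhileTrue: "eval_expr b s \<noteq> 0 \<Longrightarrow> runs c s t1 s1 \<Longrightarrow> runs (WhileNZ b c) s1 t2 s2 \<Longrightarrow>
    runs (WhileNZ b c) s (expr_cost b + 1 + t1 + t2) s2"

lemma runs_deterministic:
  "runs c s t s' \<Longrightarrow> runs c s u s'' \<Longrightarrow> u = t \<and> s'' = s'"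
proof (induction arbitrary: u s'' rule: runs.induct)
  case (Skip s)
  from Skip.prems show ?case by cases simp
next
  case (Write a i e s)
  from Write.prems show ?case by cases simp
next
  case (Seq c1 s t1 s1 c2 t2 s2)
  from Seq.prems show ?case
    by cases (use Seq.IH in blast)
next
  case (IfTrue b s c1 t s' c2)
  from IfTrue.prems show ?case
    by cases (use IfTrue.hyps IfTrue.IH in blast)+
next
  case (IfFalse b s c2 t s' c1)
  from IfFalse.prems show ?case
    by cases (use IfFalse.hyps IfFalse.IH in blast)+
next
  case (WhileFalse b s c)
  from WhileFalse.prems show ?case
    by cases (use WhileFalse.hyps in simp_all)
next
  case (WhileTrue b s c t1 s1 t2 s2)
  from WhileTrue.prems show ?case
    by cases (use WhileTrue.hyps WhileTrue.IH in blast)+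
qed


section \<open>Graphs as input, colorings as output\<close>

text \<open>
  An input graph has vertices \<open>0, \<dots>, n - 1\<close>. Its edges are listed without repetition, in any
  order and with the endpoints of each edge in any order.
\<close>

definition endpoints :: "nat \<times> nat \<Rightarrow> nat set" where
  "endpoints p = {fst p, snd p}"

definition edge_list :: "nat set set \<Rightarrow> (nat \<times> nat) list \<Rightarrow> bool" where
  "edge_list E es \<longleftrightarrow> distinct (map endpoints es) \<and> set (map endpoints es) = E"

definition input_memory :: "nat \<Rightarrow> (nat \<times> nat) list \<Rightarrow> memory" where
  "input_memory n es = (\<lambda>a i.
     if a = ''n'' \<and> i = 0 then n
     else if a = ''m'' \<and> i = 0 then length es
     else if a = ''u'' \<and> i < length es then fst (es ! i)
     else if a = ''v'' \<and> i < length es then snd (es ! i)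
     else 0)"

text \<open>On the edges of the graph, the output coloring is determined by the final memory.\<close>

definition outputs_coloring :: "(nat \<times> nat) list \<Rightarrow> memory \<Rightarrow> (nat set \<Rightarrow> nat) \<Rightarrow> bool" where
  "outputs_coloring es s \<chi> \<longleftrightarrow> (\<forall>i<length es. \<chi> (endpoints (es ! i)) = s ''color'' i)"

end

theory Submission
  imports Defs
begin

text \<open>
  At every vertex of degree 3 some two incident edges must share a color. Start with all edges
  colored differently and, at each of the \<open>n\<^sub>3\<close> vertices of degree 3, merge the colors of two
  incident edges; this loses at most one color per vertex and leaves at least \<open>m - n\<^sub>3\<close> colors.
  For a triangle on three vertices of degree 3, merging its three edges serves all three
  vertices at the cost of only two colors, so \<open>\<tau>\<close> vertex-disjoint triangles leave at least
  \<open>m - n\<^sub>3 + \<tau>\<close> colors; they are chosen greedily.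

  Conversely, consider a color class with \<open>k\<close> edges in which \<open>x\<close> vertices of degree 3 have two
  edges. Then \<open>k - 1 \<ge> 3x/4\<close>, unless the class contains the triangle on these vertices, where
  the inequality fails by 1/4 only. As every vertex of degree 3 is counted in exactly one class,
  and each exceptional triangle contains one of the \<open>3\<tau>\<close> vertices of the greedy triangles,
  summation gives \<open>opt \<le> m - 3n\<^sub>3/4 + 3\<tau>/4\<close>. Together with \<open>3n\<^sub>3 \<le> 2m\<close> this is at most
  \<open>3/2 (m - n\<^sub>3 + \<tau>)\<close>.
\<close>

section \<open>Upper bound on the number of colors\<close>

lemma sum_card_incident:
  assumes "finite C" "finite X"
  shows "(\<Sum>v\<in>X. card (incident_edges C v)) = (\<Sum>e\<in>C. card (e \<inter> X))"
proof -
  have "(\<Sum>v\<in>X. card (incident_edges C v)) = (\<Sum>v\<in>X. \<Sum>e\<in>C. if v \<in> e then 1 else 0)"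
    using assms by (intro sum.cong) (auto simp: incident_edges_def sum.If_cases Int_def)
  also have "\<dots> = (\<Sum>e\<in>C. \<Sum>v\<in>X. if v \<in> e then 1 else 0)"
    by (rule sum.swap)
  also have "\<dots> = (\<Sum>e\<in>C. card (e \<inter> X))"
  proof (rule sum.cong)
    fix e
    show "(\<Sum>v\<in>X. if v \<in> e then 1 else 0) = card (e \<inter> X)"
      using assms by (simp add: sum.If_cases Int_commute)
  qed simp
  finally show ?thesis .
qed

text \<open>Double counting of incidences gives 2x \<le> |C| + |I|, where x = |X| and
  \<open>I\<close> holds the edges inside \<open>X\<close>. Combine this with |I| \<le> x choose 2
  for x \<le> 3 and with |I| \<le> |C| for x \<ge> 4. Only x = |I| = 3 misses the bound, by
  one.\<close>

lemma card_edges_ge: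
  assumes "finite C" "C \<noteq> {}" "\<And>e. e \<in> C \<Longrightarrow> card e = 2" "finite X"
    and deg: "\<And>v. v \<in> X \<Longrightarrow> card (incident_edges C v) \<ge> 2"
  shows "4 + 3 * card X \<le> 4 * card C \<or> 
    (4 + 3 * card X \<le> 4 * card C + 1 \<and> card X = 3 \<and> {e. e \<subseteq> X \<and> card e = 2} \<subseteq> C)"
proof -
  define I where "I = {e \<in> C. e \<subseteq> X}"
  have "finite I" using assms by (auto simp: I_def)
  have two_sub: "e \<subseteq> X \<or> card (e \<inter> X) \<le> 1" if "e \<in> C" for e
  proof (rule ccontr)
    assume n: "\<not> (e \<subseteq> X \<or> card (e \<inter> X) \<le> 1)"
    have "finite e" using assms(3)[OF that] by (metis card.infinite zero_neq_numeral)
    moreover have "e \<inter> X \<subset> e" using n by auto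
    ultimately have "card (e \<inter> X) < card e" by (rule psubset_card_mono)
    then show False using n assms(3)[OF that] by auto
  qed
  have "2 * card X \<le> (\<Sum>v\<in>X. card (incident_edges C v))"
    using sum_mono[of X "\<lambda>_. 2" "\<lambda>v. card (incident_edges C v)"] deg by (simp add: mult.commute)
  also have "\<dots> = (\<Sum>e\<in>C. card (e \<inter> X))"
    using assms sum_card_incident by blast
  \<comment> \<open>An edge meets \<open>X\<close> in two vertices only if it lies inside
    \<open>X\<close>.\<close>
  also have "\<dots> \<le> (\<Sum>e\<in>C. 1 + (if e \<subseteq> X then 1 else 0))"
  proof (rule sum_mono)
    fix e assume "e \<in> C"
    show "card (e \<inter> X) \<le> 1 + (if e \<subseteq> X then 1 else 0)"
      using two_sub[OF \<open>e \<in> C\<close>] assms(3)[OF \<open>e \<in> C\<close>] by (auto simp: Int_absorb2)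
  qed
  also have "\<dots> = card C + card I"
    unfolding sum.distrib I_def using assms by (simp add: sum.If_cases Int_def)
  finally have main: "2 * card X \<le> card C + card I" .
  have IC: "card I \<le> card C" using assms by (auto simp: I_def intro: card_mono)
  have C1: "card C \<ge> 1" using assms by (simp add: Suc_leI card_gt_0_iff)
  have Isub: "I \<subseteq> {e. e \<subseteq> X \<and> card e = 2}" using assms by (auto simp: I_def)
  have fin2: "finite {e. e \<subseteq> X \<and> card e = 2}" using assms by auto
  have Ich: "card I \<le> card X choose 2"
    using card_mono[OF fin2 Isub] n_subsets[OF \<open>finite X\<close>, of 2] by simp
  consider "card X = 0" | "card X = 1" | "card X = 2" | "card X = 3" | "card X \<ge> 4" by linarith
  then show ?thesis
  proof cases
    case 4
    then have ch: "card X choose 2 = 3" by (simp add: numeral_eq_Suc)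
    show ?thesis
    proof (cases "card I = 3")
      case True
      then have "I = {e. e \<subseteq> X \<and> card e = 2}"
        using card_subset_eq[OF fin2 Isub] n_subsets[OF \<open>finite X\<close>, of 2] ch by simp
      then have "{e. e \<subseteq> X \<and> card e = 2} \<subseteq> C" by (auto simp: I_def)
      then show ?thesis using main True 4 by linarith
    qed (use main Ich ch 4 in linarith)
  qed (use main Ich IC C1 in \<open>auto simp: numeral_eq_Suc\<close>)
qed

text \<open>\<open>X k\<close> collects the degree-3 vertices with two edges of color
  \<open>k\<close>. These sets partition \<open>S\<close>, so the bounds for the single color
  classes can be summed.\<close>

lemma num_colors_upper_bound:
  assumes G: "simple_graph V E" "subcubic V E" and col: "edge_2_coloring V E \<chi>"
    and S: "S = {v \<in> V. card (incident_edges E v) = 3}"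
    and "finite D"
    and hit: "\<And>a b c. {a, b, c} \<subseteq> S \<Longrightarrow> card {a, b, c} = 3 \<Longrightarrow> 
      {a, b} \<in> E \<Longrightarrow> {b, c} \<in> E \<Longrightarrow> {c, a} \<in> E \<Longrightarrow> {a, b, c} \<inter> D \<noteq> {}"
  shows "4 * num_colors E \<chi> + 3 * card S \<le> 4 * card E + card D"
proof -
  have finE: "finite E" using G simple_graph_finite_edges by blast
  have finS: "finite S" using G S by (simp add: simple_graph_def)
  define C where "C k = {e \<in> E. \<chi> e = k}" for k
  define X where "X k = {v \<in> S. card (incident_edges (C k) v) \<ge> 2}" for k
  have finI: "finite (incident_edges E v)" for v using finE by (simp add: incident_edges_def)
  \<comment> \<open>The missing unit of an exceptional class is paid by a vertex of \<open>D\<close>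
    on its triangle.\<close>
  have class_bound: "4 + 3 * card (X k) \<le> 4 * card (C k) + card (X k \<inter> D)" if k: "k \<in> \<chi> ` E" for k
  proof -
    have "4 + 3 * card (X k) \<le> 4 * card (C k) \<or>
      (4 + 3 * card (X k) \<le> 4 * card (C k) + 1 \<and> card (X k) = 3 \<and> {e. e \<subseteq> X k \<and> card e = 2} \<subseteq> C k)"
      using k finE finS G by (intro card_edges_ge) (auto simp: C_def X_def simple_graph_def)
    moreover have "card (X k \<inter> D) \<ge> 1" if "card (X k) = 3" "{e. e \<subseteq> X k \<and> card e = 2} \<subseteq> C k"
    proof -
      obtain a b c where abc: "X k = {a, b, c}" "a \<noteq> b" "b \<noteq> c" "a \<noteq> c"
        using \<open>card (X k) = 3\<close> by (auto simp: numeral_eq_Suc card_Suc_eq)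
      have "{{a, b}, {b, c}, {c, a}} \<subseteq> {e. e \<subseteq> X k \<and> card e = 2}" using abc by auto
      also have "\<dots> \<subseteq> E" using that by (auto simp: C_def)
      finally have "X k \<inter> D \<noteq> {}"
        unfolding abc(1) using abc that by (intro hit) (auto simp: X_def)
      moreover have "finite (X k \<inter> D)" using \<open>finite D\<close> by blast
      ultimately show ?thesis by (simp add: Suc_leI card_gt_0_iff)
    qed
    ultimately show ?thesis by linarith
  qed
  \<comment> \<open>Two edges in each of two classes would need degree 4.\<close>
  have disj: "k = l" if "v \<in> X k" "v \<in> X l" for v k l
  proof (rule ccontr)
    assume "k \<noteq> l"
    then have "incident_edges (C k) v \<inter> incident_edges (C l) v = {}"
      by (auto simp: incident_edges_def C_def)
    moreover have "incident_edges (C k) v \<union> incident_edges (C l) v \<subseteq> incident_edges E v"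
      by (auto simp: incident_edges_def C_def)
    ultimately have "card (incident_edges (C k) v) + card (incident_edges (C l) v) \<le> card (incident_edges E v)"
      using card_mono[OF finI] finI by (metis card_Un_disjoint finite_Un finite_subset)
    then show False using that by (auto simp: X_def S)
  qed
  \<comment> \<open>Pigeonhole: three edges at \<open>v\<close> carry at most two colors.\<close>
  have cover: "S \<subseteq> (\<Union>k\<in>\<chi> ` E. X k)"
  proof
    fix v assume v: "v \<in> S"
    then have "card (\<chi> ` incident_edges E v) < card (incident_edges E v)"
      using col S by (force simp: edge_2_coloring_def)
    then have "\<not> inj_on \<chi> (incident_edges E v)" by (rule pigeonhole)
    then obtain e f where ef: "e \<in> incident_edges E v" "f \<in> incident_edges E v" "e \<noteq> f" "\<chi> e = \<chi> f"
      by (auto simp: inj_on_def)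
    then have "{e, f} \<subseteq> incident_edges (C (\<chi> e)) v" by (auto simp: incident_edges_def C_def)
    moreover have "finite (incident_edges (C (\<chi> e)) v)" using finE by (simp add: incident_edges_def C_def)
    ultimately have "card {e, f} \<le> card (incident_edges (C (\<chi> e)) v)" by (metis card_mono)
    then have "v \<in> X (\<chi> e)" using v ef by (simp add: X_def)
    then show "v \<in> (\<Union>k\<in>\<chi> ` E. X k)" using ef by (auto simp: incident_edges_def)
  qed
  have finX: "finite (X k)" for k using finS by (simp add: X_def)
  have "card S \<le> card (\<Union>k\<in>\<chi> ` E. X k)" using cover finE finX by (intro card_mono) auto
  also have "\<dots> \<le> (\<Sum>k\<in>\<chi> ` E. card (X k))" using finE by (intro card_UN_le) auto
  finally have 1: "card S \<le> (\<Sum>k\<in>\<chi> ` E. card (X k))" .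
  \<comment> \<open>By disjointness no vertex of \<open>D\<close> pays for two classes.\<close>
  have "(\<Sum>k\<in>\<chi> ` E. card (X k \<inter> D)) = card (\<Union>k\<in>\<chi> ` E. X k \<inter> D)"
    using finE finX disj by (subst card_UN_disjoint) auto
  also have "\<dots> \<le> card D" using \<open>finite D\<close> by (intro card_mono) auto
  finally have 2: "(\<Sum>k\<in>\<chi> ` E. card (X k \<inter> D)) \<le> card D" .
  have 3: "(\<Sum>k\<in>\<chi> ` E. card (C k)) = card E"
    using sum.image_gen[OF finE, of "\<lambda>_. 1::nat" \<chi>] by (simp add: C_def)
  have "(\<Sum>k\<in>\<chi> ` E. 4 + 3 * card (X k)) \<le> (\<Sum>k\<in>\<chi> ` E. 4 * card (C k) + card (X k \<inter> D))"
    using class_bound by (rule sum_mono)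
  then have "4 * card (\<chi> ` E) + 3 * (\<Sum>k\<in>\<chi> ` E. card (X k)) \<le>
      4 * (\<Sum>k\<in>\<chi> ` E. card (C k)) + (\<Sum>k\<in>\<chi> ` E. card (X k \<inter> D))"
    by (simp add: sum.distrib sum_distrib_left mult.commute)
  then show ?thesis using 1 2 3 unfolding num_colors_def by linarith
qed

lemma three_card_cubic_le:
  assumes "simple_graph V E"
  shows "3 * card {v \<in> V. card (incident_edges E v) = 3} \<le> 2 * card E"
proof -
  have finE: "finite E" using assms simple_graph_finite_edges by blast
  let ?S = "{v \<in> V. card (incident_edges E v) = 3}"
  have finS: "finite ?S" using assms by (simp add: simple_graph_def)
  have "3 * card ?S = (\<Sum>v\<in>?S. card (incident_edges E v))" by simp
  also have "\<dots> = (\<Sum>e\<in>E. card (e \<inter> ?S))" using finE finS by (rule sum_card_incident)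
  also have "\<dots> \<le> (\<Sum>e\<in>E. 2)"
  proof (rule sum_mono)
    fix e assume "e \<in> E"
    then have "card e = 2" using assms by (auto simp: simple_graph_def)
    moreover from this have "finite e" by (metis card.infinite zero_neq_numeral)
    ultimately show "card (e \<inter> ?S) \<le> 2" by (metis card_mono inf_le1)
  qed
  finally show ?thesis by simp
qed

section \<open>Total correctness with a time bound\<close>

text \<open>As \<open>runs\<close> is deterministic, the existence of one such run is total
  correctness. \<open>B\<close> is only an upper bound, so costs may be rounded up.\<close>

definition halts :: "prog \<Rightarrow> memory \<Rightarrow> nat \<Rightarrow> (memory \<Rightarrow> bool) \<Rightarrow> bool" where
  "halts c s B Q \<longleftrightarrow> (\<exists>t s'. runs c s t s' \<and> t \<le> B \<and> Q s')"

fun writes :: "prog \<Rightarrow> string set" where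
  "writes Skip = {}"
| "writes (Write a i e) = {a}"
| "writes (Seq c1 c2) = writes c1 \<union> writes c2"
| "writes (IfNZ b c1 c2) = writes c1 \<union> writes c2"
| "writes (WhileNZ b c) = writes c"

lemma runs_frame: "runs c s t s' \<Longrightarrow> a \<notin> writes c \<Longrightarrow> s' a = s a"
  by (induction rule: runs.induct) auto

lemma halts_mono: "halts c s B Q \<Longrightarrow> B \<le> B' \<Longrightarrow> (\<And>s'. Q s' \<Longrightarrow> R s') \<Longrightarrow> halts c s B' R"
  unfolding halts_def by (meson le_trans)

lemma halts_frame:
  "halts c s B Q \<Longrightarrow> (\<And>s'. Q s' \<Longrightarrow> (\<forall>a. a \<notin> writes c \<longrightarrow> s' a = s a) \<Longrightarrow> R s') \<Longrightarrow> halts c s B R"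
  unfolding halts_def using runs_frame by meson

lemma halts_Skip: "Q s \<Longrightarrow> 1 \<le> B \<Longrightarrow> halts Skip s B Q"
  unfolding halts_def using runs.Skip by blast

lemma halts_Write:
  "Q (s(a := (s a)(eval_expr i s := eval_expr e s))) \<Longrightarrow> expr_cost i + expr_cost e + 1 \<le> B \<Longrightarrow>
    halts (Write a i e) s B Q"
  unfolding halts_def using runs.Write by blast

lemma halts_Seq:
  assumes "halts c1 s B1 R" "\<And>s'. R s' \<Longrightarrow> halts c2 s' B2 Q"
  shows "halts (Seq c1 c2) s (B1 + B2) Q"
  using assms unfolding halts_def by (meson runs.Seq add_mono)

lemma halts_Write_Seq:
  assumes "halts c (s(a := (s a)(eval_expr i s := eval_expr e s))) B Q"
  shows "halts (Seq (Write a i e) c) s (expr_cost i + expr_cost e + 1 + B) Q"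
  by (rule halts_Seq[where R = "\<lambda>s'. s' = s(a := (s a)(eval_expr i s := eval_expr e s))"])
    (use assms in \<open>auto intro: halts_Write\<close>)

lemma halts_If:
  assumes "eval_expr b s \<noteq> 0 \<Longrightarrow> halts c1 s B Q" "eval_expr b s = 0 \<Longrightarrow> halts c2 s B Q"
  shows "halts (IfNZ b c1 c2) s (expr_cost b + 1 + B) Q"
proof (cases "eval_expr b s = 0")
  case True
  with assms obtain t s' where "runs c2 s t s'" "t \<le> B" "Q s'" by (auto simp: halts_def)
  then show ?thesis using runs.IfFalse[OF True] unfolding halts_def by (meson add_left_mono)
next
  case False
  with assms obtain t s' where "runs c1 s t s'" "t \<le> B" "Q s'" by (auto simp: halts_def)
  then show ?thesis using runs.IfTrue[OF False] unfolding halts_def by (meson add_left_mono)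
qed

abbreviation Reg :: "string \<Rightarrow> expr" where
  "Reg x \<equiv> Read x (Const 0)"

text \<open>Truncated subtraction makes the loop test nonzero exactly while the counter is below the
  bound.\<close>

definition For :: "string \<Rightarrow> string \<Rightarrow> prog \<Rightarrow> prog" where
  "For x b c = Seq (Write x (Const 0) (Const 0))
     (WhileNZ (Sub (Reg b) (Reg x)) (Seq c (Write x (Const 0) (Add (Reg x) (Const 1)))))"

lemma writes_For [simp]: "writes (For x b c) = insert x (writes c)"
  by (auto simp: For_def)

text \<open>Each round costs 6 for the test and 6 for the increment besides the body; the 9 covers
  the initial write (3) and the failing last test (6).\<close>

definition for_cost :: "nat \<Rightarrow> nat \<Rightarrow> nat" where
  "for_cost N B = N * (B + 12) + 9"

text \<open>The invariant receives the round number as an argument and must not depend on the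
  counter array, so it survives the reset and the increments of \<open>x\<close>.\<close>

lemma halts_For:
  assumes names: "x \<noteq> b" "x \<notin> writes c" "b \<notin> writes c"
    and inv: "\<And>k s v. I k s \<Longrightarrow> I k (s(x := v))"
    and body: "\<And>k s. k < N \<Longrightarrow> s b 0 = N \<Longrightarrow> s x 0 = k \<Longrightarrow> I k s \<Longrightarrow> halts c s B (I (Suc k))"
    and init: "s b 0 = N" "I 0 s"
  shows "halts (For x b c) s (for_cost N B) (I N)"
proof -
  let ?w = "WhileNZ (Sub (Reg b) (Reg x)) (Seq c (Write x (Const 0) (Add (Reg x) (Const 1))))"
  have loop: "halts ?w s ((N - k) * (B + 12) + 6) (I N)"
    if "k \<le> N" "s b 0 = N" "s x 0 = k" "I k s" for k s
    using that
  proof (induction "N - k" arbitrary: k s)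
    case 0
    then have "runs ?w s (expr_cost (Sub (Reg b) (Reg x)) + 1) s" by (intro runs.WhileFalse) simp
    then show ?case using 0 unfolding halts_def by fastforce
  next
    case (Suc n)
    then have k: "k < N" by linarith
    obtain t1 s1 where r1: "runs c s t1 s1" "t1 \<le> B" "I (Suc k) s1"
      using body[OF k] Suc.prems unfolding halts_def by blast
    have fr: "s1 b = s b" "s1 x = s x" using runs_frame[OF r1(1)] names by blast+
    define s2 where "s2 = s1(x := (s1 x)(0 := Suc k))"
    have "runs (Seq c (Write x (Const 0) (Add (Reg x) (Const 1)))) s (t1 + 6) s2"
      using runs.Seq[OF r1(1) runs.Write[of x "Const 0" "Add (Reg x) (Const 1)" s1]] Suc.prems fr
      by (simp add: s2_def numeral_eq_Suc)
    moreover have "halts ?w s2 ((N - Suc k) * (B + 12) + 6) (I N)"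
      using Suc.hyps(2) Suc.prems k fr names r1(3) inv[OF r1(3)]
      by (intro Suc.hyps(1)) (auto simp: s2_def)
    then obtain t2 s3 where r2: "runs ?w s2 t2 s3" "t2 \<le> (N - Suc k) * (B + 12) + 6" "I N s3"
      unfolding halts_def by blast
    ultimately have "runs ?w s (expr_cost (Sub (Reg b) (Reg x)) + 1 + (t1 + 6) + t2) s3"
      using k Suc.prems by (intro runs.WhileTrue) auto
    moreover have "N - k = Suc (N - Suc k)" using k by simp
    then have "expr_cost (Sub (Reg b) (Reg x)) + 1 + (t1 + 6) + t2 \<le> (N - k) * (B + 12) + 6"
      using r1(2) r2(2) by simp
    ultimately show ?case using r2(3) unfolding halts_def by blast
  qed
  have "halts ?w (s(x := (s x)(0 := 0))) ((N - 0) * (B + 12) + 6) (I N)"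
    using init names inv by (intro loop) auto
  then have "halts ?w (s(x := (s x)(eval_expr (Const 0) s := eval_expr (Const 0) s))) (N * (B + 12) + 6) (I N)"
    by simp
  from halts_Write_Seq[OF this] show ?thesis
    unfolding For_def for_cost_def by (rule halts_mono) auto
qed

text \<open>One of the two truncated differences is 0, so this is |a - b|. With 0 as success, a
  conjunction of equalities becomes a sum.\<close>

definition Neq :: "expr \<Rightarrow> expr \<Rightarrow> expr" where
  "Neq a b = Add (Sub a b) (Sub b a)"

lemma eval_Neq [simp]: "eval_expr (Neq a b) s = 0 \<longleftrightarrow> eval_expr a s = eval_expr b s"
  by (auto simp: Neq_def)

lemma cost_Neq [simp]: "expr_cost (Neq a b) = 2 * expr_cost a + 2 * expr_cost b + 3"
  by (simp add: Neq_def)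

section \<open>Recoloring\<close>

definition relabel :: "nat \<Rightarrow> nat \<Rightarrow> nat \<Rightarrow> (nat \<Rightarrow> nat) \<Rightarrow> nat \<Rightarrow> nat" where
  "relabel m x y c = (\<lambda>l. if l < m \<and> c l = x then y else c l)"

text \<open>The registers \<open>p\<close> and \<open>q\<close> hold darts, which \<open>id\<close>
  turns into edges. Both colors are saved first because the loop overwrites
  \<open>color\<close>.\<close>

definition Merge :: "string \<Rightarrow> string \<Rightarrow> prog" where
  "Merge p q =
     Seq (Write ''x'' (Const 0) (Read ''color'' (Read ''id'' (Reg p))))
    (Seq (Write ''y'' (Const 0) (Read ''color'' (Read ''id'' (Reg q))))
    (For ''l'' ''m''
      (IfNZ (Neq (Read ''color'' (Reg ''l'')) (Reg ''x''))
        Skip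
        (Write ''color'' (Reg ''l'') (Reg ''y'')))))"

lemma writes_Merge [simp]: "writes (Merge p q) = {''x'', ''y'', ''l'', ''color''}"
  by (auto simp: Merge_def)

definition merge_cost :: "nat \<Rightarrow> nat" where
  "merge_cost m = 12 + for_cost m 20"

lemma halts_Merge:
  assumes "s ''m'' 0 = m" "p \<notin> {''x'', ''y'', ''l'', ''color''}" "q \<notin> {''x'', ''y'', ''l'', ''color''}"
  shows "halts (Merge p q) s (merge_cost m) (\<lambda>s'.
    s' ''color'' = relabel m (s ''color'' (s ''id'' (s p 0))) (s ''color'' (s ''id'' (s q 0))) (s ''color'') \<and>
    (\<forall>a. a \<notin> writes (Merge p q) \<longrightarrow> s' a = s a))"
proof -
  let ?X = "s ''color'' (s ''id'' (s p 0))" and ?Y = "s ''color'' (s ''id'' (s q 0))"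
  \<comment> \<open>The first argument of \<open>relabel\<close> serves as the number of positions
    already processed.\<close>
  define I where "I k s' \<longleftrightarrow> s' ''x'' 0 = ?X \<and> s' ''y'' 0 = ?Y \<and>
    s' ''color'' = relabel k ?X ?Y (s ''color'')" for k s'
  let ?body = "IfNZ (Neq (Read ''color'' (Reg ''l'')) (Reg ''x'')) Skip (Write ''color'' (Reg ''l'') (Reg ''y''))"
  have loop: "halts (For ''l'' ''m'' ?body) s' (for_cost m 20) (I m)" if "s' ''m'' 0 = m" "I 0 s'" for s'
  proof (rule halts_For)
    fix k s assume k: "k < m" "s ''m'' 0 = m" "s ''l'' 0 = k" "I k s"
    have "halts ?body s (expr_cost (Neq (Read ''color'' (Reg ''l'')) (Reg ''x'')) + 1 + 6) (I (Suc k))"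
      by (intro halts_If halts_Skip halts_Write)
        (use k in \<open>auto simp: I_def relabel_def less_Suc_eq fun_eq_iff\<close>)
    then show "halts ?body s 20 (I (Suc k))" by simp
  qed (use that in \<open>auto simp: I_def\<close>)
  have "halts (Merge p q) s (12 + for_cost m 20) (I m)"
    unfolding Merge_def
    by (rule halts_mono, (rule halts_Write_Seq)+, rule loop) (use assms in \<open>auto simp: I_def relabel_def\<close>)
  then show ?thesis
    unfolding merge_cost_def by (rule halts_frame) (auto simp: I_def)
qed

section \<open>Effect of the merges on the number of colors\<close>

lemma relabel_image:
  "A \<subseteq> {..<m} \<Longrightarrow> relabel m x y c ` A = (\<lambda>z. if z = x then y else z) ` c ` A"
  unfolding relabel_def image_image by (intro image_cong) auto

lemma card_relabel_image_le:
  "A \<subseteq> {..<m} \<Longrightarrow> card (relabel m x y c ` A) \<le> card (c ` A)"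
  unfolding relabel_image by (intro card_image_le finite_imageI) (simp add: finite_subset)

text \<open>Only the color \<open>x\<close> can disappear.\<close>

lemma card_colors_relabel: "card (c ` {..<m}) \<le> card (relabel m x y c ` {..<m}) + 1"
proof -
  have "c ` {..<m} \<subseteq> insert x (relabel m x y c ` {..<m})"
    by (force simp: relabel_def image_iff)
  then have "card (c ` {..<m}) \<le> card (insert x (relabel m x y c ` {..<m}))"
    by (intro card_mono) auto
  also have "\<dots> \<le> card (relabel m x y c ` {..<m}) + 1"
    by (simp add: card_insert_if)
  finally show ?thesis .
qed

locale subcubic_edges =
  fixes e :: "nat \<Rightarrow> nat set" and m :: nat
  assumes card_edge: "l < m \<Longrightarrow> card (e l) = 2"
    and inj_edges: "inj_on e {..<m}"
    and deg_le: "card {l. l < m \<and> w \<in> e l} \<le> 3"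
begin

definition inc :: "nat \<Rightarrow> nat set" where
  "inc w = {l. l < m \<and> w \<in> e l}"

definition cubic :: "nat set" where
  "cubic = {w. card (inc w) = 3}"

text \<open>A finished vertex is recorded by overwriting its degree with 0.\<close>

definition finished :: "(nat \<Rightarrow> nat) \<Rightarrow> nat set" where
  "finished d = {w \<in> cubic. d w = 0}"

text \<open>The array \<open>d\<close> has a double role: the value 3 certifies an unfinished vertex
  of degree 3, while 0 at a vertex of degree 3 certifies that it sees at most two colors.\<close>

definition consistent :: "(nat \<Rightarrow> nat) \<Rightarrow> (nat \<Rightarrow> nat) \<Rightarrow> bool" where
  "consistent c d \<longleftrightarrow> (\<forall>w. d w = card (inc w) \<or> (d w = 0 \<and> w \<in> cubic \<and> card (c ` inc w) \<le> 2))"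

lemma finite_inc [simp]: "finite (inc w)"
  by (simp add: inc_def)

lemma inc_subset: "inc w \<subseteq> {..<m}"
  by (auto simp: inc_def)

lemma finite_edge: "l < m \<Longrightarrow> finite (e l)"
  using card_edge by (metis card.infinite zero_neq_numeral)

lemma finite_cubic: "finite cubic"
proof (rule finite_subset)
  show "cubic \<subseteq> (\<Union>l<m. e l)"
  proof
    fix w assume "w \<in> cubic"
    then have "inc w \<noteq> {}" by (auto simp: cubic_def)
    then show "w \<in> (\<Union>l<m. e l)" by (auto simp: inc_def)
  qed
qed (use finite_edge in auto)

lemma finite_finished [simp]: "finite (finished d)"
  using finite_cubic by (auto simp: finished_def)

lemma consistent_cubic: "consistent c d \<Longrightarrow> d w = 3 \<Longrightarrow> w \<in> cubic"
  by (force simp: consistent_def cubic_def)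

text \<open>Merging acts as a map on colors, so it never adds a color at a vertex and later merges
  cannot spoil finished vertices.\<close>

lemma consistent_relabel: "consistent c d \<Longrightarrow> consistent (relabel m x y c) d"
  unfolding consistent_def using card_relabel_image_le[OF inc_subset] le_trans by blast

lemma consistent_mark:
  "consistent c d \<Longrightarrow> w \<in> cubic \<Longrightarrow> card (c ` inc w) \<le> 2 \<Longrightarrow> consistent c (d(w := 0))"
  by (simp add: consistent_def)

lemma finished_mark: "w \<in> cubic \<Longrightarrow> finished (d(w := 0)) = insert w (finished d)"
  by (auto simp: finished_def)

lemma card_colors_at_le_2:
  assumes "w \<in> cubic" "l1 \<in> inc w" "l2 \<in> inc w" "l1 \<noteq> l2" "c l1 = c l2"
  shows "card (c ` inc w) \<le> 2"
proof -
  \<comment> \<open>The edge \<open>l2\<close> still supplies the color of \<open>l1\<close>, and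
    only two edges remain.\<close>
  have "c ` inc w = c ` (inc w - {l1})" using assms by (auto simp: image_iff)
  then have "card (c ` inc w) \<le> card (inc w - {l1})" by (simp add: card_image_le)
  then show ?thesis using assms by (simp add: cubic_def)
qed

text \<open>At most one color is lost and exactly one vertex becomes finished.\<close>

lemma pair_step:
  assumes cons: "consistent c d" and ij: "i \<in> inc w" "j \<in> inc w" "i \<noteq> j" and "d w = 3"
  defines "c' \<equiv> relabel m (c i) (c j) c"
  shows "consistent c' (d(w := 0))"
    and "card (c ` {..<m}) + card (finished d) \<le> card (c' ` {..<m}) + card (finished (d(w := 0)))"
proof -
  have w: "w \<in> cubic" using consistent_cubic[OF cons \<open>d w = 3\<close>] .
  have "c' i = c' j" using ij by (auto simp: c'_def relabel_def inc_def)
  then show "consistent c' (d(w := 0))"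
    using card_colors_at_le_2[OF w ij] cons w
    by (intro consistent_mark) (auto simp: c'_def intro: consistent_relabel)
  have "w \<notin> finished d" using \<open>d w = 3\<close> by (simp add: finished_def)
  then show "card (c ` {..<m}) + card (finished d) \<le> card (c' ` {..<m}) + card (finished (d(w := 0)))"
    using card_colors_relabel[of c m "c i" "c j"] w by (simp add: finished_mark c'_def)
qed

text \<open>Two merges give the three edges a common color, and each corner lies on two of them.
  Losing at most two colors for three finished vertices explains the weights 3 and 2.\<close>

lemma triangle_step:
  assumes cons: "consistent c d" and lt: "i < m" "j < m" "k < m"
    and e: "e i = {p, q}" "e j = {q, r}" "e k = {r, p}" and d: "d p = 3" "d q = 3" "d r = 3"
  defines "c1 \<equiv> relabel m (c i) (c j) c"
  defines "c2 \<equiv> relabel m (c1 j) (c1 k) c1"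
  defines "d' \<equiv> d(p := 0, q := 0, r := 0)"
  shows "consistent c2 d'"
    and "3 * card (c ` {..<m}) + 2 * card (finished d) \<le> 3 * card (c2 ` {..<m}) + 2 * card (finished d')"
proof -
  have cub: "p \<in> cubic" "q \<in> cubic" "r \<in> cubic" using consistent_cubic[OF cons] d by auto
  have ne: "p \<noteq> q" "q \<noteq> r" "r \<noteq> p" using card_edge[OF lt(1)] card_edge[OF lt(2)] card_edge[OF lt(3)] e by auto
  then have ne': "i \<noteq> j" "j \<noteq> k" "k \<noteq> i" using e by auto
  have "c1 i = c1 j" using lt by (auto simp: c1_def relabel_def)
  then have eq: "c2 i = c2 j" "c2 j = c2 k" using lt by (auto simp: c2_def relabel_def)
  have "card (c2 ` inc p) \<le> 2" "card (c2 ` inc q) \<le> 2" "card (c2 ` inc r) \<le> 2"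
    using card_colors_at_le_2[OF cub(1), of i k c2] card_colors_at_le_2[OF cub(2), of i j c2]
      card_colors_at_le_2[OF cub(3), of j k c2] lt e ne' eq by (auto simp: inc_def)
  moreover have "consistent c2 d" using cons by (simp add: c2_def c1_def consistent_relabel)
  ultimately show "consistent c2 d'" unfolding d'_def using cub by (intro consistent_mark) auto
  have "finished d' = insert r (insert q (insert p (finished d)))"
    using cub by (simp add: d'_def finished_mark)
  moreover have "p \<notin> finished d" "q \<notin> finished d" "r \<notin> finished d" using d by (auto simp: finished_def)
  ultimately have "card (finished d') = card (finished d) + 3" using ne by simp
  moreover have "card (c ` {..<m}) \<le> card (c2 ` {..<m}) + 2"
    using card_colors_relabel[of c m "c i" "c j"] card_colors_relabel[of c1 m "c1 j" "c1 k"]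
    by (simp add: c1_def c2_def)
  ultimately show "3 * card (c ` {..<m}) + 2 * card (finished d) \<le> 3 * card (c2 ` {..<m}) + 2 * card (finished d')"
    by linarith
qed

end

section \<open>The program\<close>

definition Mark :: "string \<Rightarrow> prog" where
  "Mark x = Write ''d'' (Read ''u'' (Reg x)) (Const 0)"

abbreviation Deg :: "string \<Rightarrow> expr" where
  "Deg x \<equiv> Read ''d'' (Read ''u'' (Reg x))"

text \<open>The test is 0 when the three darts close up head to tail and their tails are unfinished
  vertices of degree 3. These tails are the corners, hence the marks.\<close>

definition Triangle_Step :: prog where
  "Triangle_Step =
    IfNZ (Add (Neq (Read ''v'' (Reg ''i'')) (Read ''u'' (Reg ''j'')))
         (Add (Neq (Read ''v'' (Reg ''j'')) (Read ''u'' (Reg ''k'')))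
         (Add (Neq (Read ''v'' (Reg ''k'')) (Read ''u'' (Reg ''i'')))
         (Add (Neq (Deg ''i'') (Const 3))
         (Add (Neq (Deg ''j'') (Const 3))
              (Neq (Deg ''k'') (Const 3)))))))
      Skip
      (Seq (Merge ''i'' ''j'') (Seq (Merge ''j'' ''k'')
      (Seq (Mark ''i'') (Seq (Mark ''j'') (Mark ''k'')))))"

text \<open>The summand \<open>Sub (Const 1) (Neq ...)\<close> negates an equality test: it vanishes
  exactly when the two darts belong to different edges.\<close>

definition Pair_Step :: prog where
  "Pair_Step =
    IfNZ (Add (Neq (Read ''u'' (Reg ''i'')) (Read ''u'' (Reg ''j'')))
         (Add (Sub (Const 1) (Neq (Read ''id'' (Reg ''i'')) (Read ''id'' (Reg ''j''))))
              (Neq (Deg ''i'') (Const 3))))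
      Skip
      (Seq (Merge ''i'' ''j'') (Mark ''i''))"

text \<open>
  Edge \<open>l\<close> is represented by the two darts \<open>l\<close> and \<open>m + l\<close>, which are its two orientations; the
  input arrays \<open>u\<close> and \<open>v\<close> are extended to darts, and \<open>id\<close> maps a dart to its edge.
\<close>

definition Init_Step :: prog where
  "Init_Step =
    Seq (Write ''u'' (Add (Reg ''m'') (Reg ''i'')) (Read ''v'' (Reg ''i'')))
   (Seq (Write ''v'' (Add (Reg ''m'') (Reg ''i'')) (Read ''u'' (Reg ''i'')))
   (Seq (Write ''id'' (Reg ''i'') (Reg ''i''))
   (Seq (Write ''id'' (Add (Reg ''m'') (Reg ''i'')) (Reg ''i''))
   (Seq (Write ''color'' (Reg ''i'') (Reg ''i''))
   (Seq (Write ''d'' (Read ''u'' (Reg ''i'')) (Add (Deg ''i'') (Const 1)))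
        (Write ''d'' (Read ''v'' (Reg ''i'')) (Add (Read ''d'' (Read ''v'' (Reg ''i''))) (Const 1))))))))"

definition Init :: prog where
  "Init = Seq (For ''i'' ''m'' Init_Step) (Write ''M'' (Const 0) (Add (Reg ''m'') (Reg ''m'')))"

definition Color_Subcubic :: prog where
  "Color_Subcubic = Seq Init
    (Seq (For ''i'' ''M'' (For ''j'' ''M'' (For ''k'' ''M'' Triangle_Step)))
         (For ''i'' ''M'' (For ''j'' ''M'' Pair_Step)))"

lemma writes_steps [simp]:
  "writes (Mark x) = {''d''}"
  "writes Triangle_Step = {''x'', ''y'', ''l'', ''color'', ''d''}"
  "writes Pair_Step = {''x'', ''y'', ''l'', ''color'', ''d''}"
  "writes Init_Step = {''u'', ''v'', ''id'', ''color'', ''d''}"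
  by (auto simp: Mark_def Triangle_Step_def Pair_Step_def Init_Step_def)

definition triangle :: "memory \<Rightarrow> nat \<Rightarrow> nat \<Rightarrow> nat \<Rightarrow> bool" where
  "triangle s i j k \<longleftrightarrow> s ''v'' i = s ''u'' j \<and> s ''v'' j = s ''u'' k \<and> s ''v'' k = s ''u'' i \<and>
     s ''d'' (s ''u'' i) = 3 \<and> s ''d'' (s ''u'' j) = 3 \<and> s ''d'' (s ''u'' k) = 3"

definition mergeable :: "memory \<Rightarrow> nat \<Rightarrow> nat \<Rightarrow> bool" where
  "mergeable s i j \<longleftrightarrow> s ''u'' i = s ''u'' j \<and> s ''id'' i \<noteq> s ''id'' j \<and> s ''d'' (s ''u'' i) = 3"

text \<open>Degree entries only ever drop to 0, so no new triangle or mergeable pair can arise. A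
  rejected candidate stays rejected and one pass over all candidates suffices.\<close>

definition progress :: "memory \<Rightarrow> memory \<Rightarrow> bool" where
  "progress s s' \<longleftrightarrow> (\<forall>a \<in> {''u'', ''v'', ''id'', ''i'', ''j'', ''k''}. s' a = s a) \<and>
     (\<forall>w. s' ''d'' w = s ''d'' w \<or> s' ''d'' w = 0)"

lemma progress_triangle: "progress s s' \<Longrightarrow> triangle s' i j k \<Longrightarrow> triangle s i j k"
  unfolding progress_def triangle_def by (simp, metis zero_neq_numeral)

lemma progress_mergeable: "progress s s' \<Longrightarrow> mergeable s' i j \<Longrightarrow> mergeable s i j"
  unfolding progress_def mergeable_def by (simp, metis zero_neq_numeral)

lemma progress_registers:
  "progress s s' \<Longrightarrow> s' ''i'' = s ''i'' \<and> s' ''j'' = s ''j'' \<and> s' ''k'' = s ''k''"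
  by (simp add: progress_def)

text \<open>Supplies the independence of loop counters that \<open>halts_For\<close> demands of
  invariants.\<close>

lemma triangle_upd [simp]:
  "triangle (s(''i'' := v)) = triangle s" "triangle (s(''j'' := v)) = triangle s"
  "triangle (s(''k'' := v)) = triangle s"
  by (simp_all add: triangle_def fun_eq_iff)

lemma mergeable_upd [simp]:
  "mergeable (s(''i'' := v)) = mergeable s" "mergeable (s(''j'' := v)) = mergeable s"
  by (simp_all add: mergeable_def fun_eq_iff)

definition triangle_cost :: "nat \<Rightarrow> nat" where
  "triangle_cost m = 2 * merge_cost m + 150"

definition pair_cost :: "nat \<Rightarrow> nat" where
  "pair_cost m = merge_cost m + 100"

section \<open>Invariants and correctness of the triangle and pair passes\<close>

context subcubic_edges
begin

text \<open>The first quantified clause makes each dart an orientation of its edge; the second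
  provides a dart leaving each endpoint of each edge, so the searches are exhaustive.\<close>

definition darts :: "memory \<Rightarrow> bool" where
  "darts s \<longleftrightarrow> s ''m'' 0 = m \<and> s ''M'' 0 = 2 * m \<and>
    (\<forall>i < 2 * m. s ''id'' i < m \<and> e (s ''id'' i) = {s ''u'' i, s ''v'' i}) \<and>
    (\<forall>l < m. \<forall>w \<in> e l. \<exists>i < 2 * m. s ''u'' i = w \<and> s ''id'' i = l)"

definition inv1 :: "memory \<Rightarrow> bool" where
  "inv1 s \<longleftrightarrow> darts s \<and> consistent (s ''color'') (s ''d'') \<and>
    3 * m \<le> 3 * card (s ''color'' ` {..<m}) + 2 * card (finished (s ''d''))"

text \<open>A merged pair trades one color for one finished vertex, hence equal weights. The
  parameter \<open>b\<close> carries the surplus of the triangle pass, namely the number of vertices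
  finished there.\<close>

definition inv2 :: "nat \<Rightarrow> memory \<Rightarrow> bool" where
  "inv2 b s \<longleftrightarrow> darts s \<and> consistent (s ''color'') (s ''d'') \<and>
    3 * m + b \<le> 3 * card (s ''color'' ` {..<m}) + 3 * card (finished (s ''d''))"

lemma inv_upd [simp]:
  "inv1 (s(''i'' := v)) = inv1 s" "inv1 (s(''j'' := v)) = inv1 s" "inv1 (s(''k'' := v)) = inv1 s"
  "inv2 b (s(''i'' := v)) = inv2 b s" "inv2 b (s(''j'' := v)) = inv2 b s"
  by (simp_all add: inv1_def inv2_def darts_def)

lemma halts_Triangle_Step:
  assumes inv: "inv1 s" and lt: "s ''i'' 0 < 2 * m" "s ''j'' 0 < 2 * m" "s ''k'' 0 < 2 * m"
  shows "halts Triangle_Step s (triangle_cost m) (\<lambda>s'. inv1 s' \<and> progress s s' \<and>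
    \<not> triangle s' (s ''i'' 0) (s ''j'' 0) (s ''k'' 0))"
    (is "halts _ _ _ ?Q")
proof -
  let ?i = "s ''i'' 0" and ?j = "s ''j'' 0" and ?k = "s ''k'' 0"
  let ?c = "s ''color''" and ?id = "s ''id''" and ?u = "s ''u''"
  let ?c1 = "relabel m (?c (?id ?i)) (?c (?id ?j)) ?c"
  let ?c2 = "relabel m (?c1 (?id ?j)) (?c1 (?id ?k)) ?c1"
  let ?d = "(s ''d'')(?u ?i := 0, ?u ?j := 0, ?u ?k := 0)"
  let ?test = "Add (Neq (Read ''v'' (Reg ''i'')) (Read ''u'' (Reg ''j'')))
    (Add (Neq (Read ''v'' (Reg ''j'')) (Read ''u'' (Reg ''k'')))
    (Add (Neq (Read ''v'' (Reg ''k'')) (Read ''u'' (Reg ''i'')))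
    (Add (Neq (Deg ''i'') (Const 3)) (Add (Neq (Deg ''j'') (Const 3)) (Neq (Deg ''k'') (Const 3))))))"
  let ?marks = "Seq (Mark ''i'') (Seq (Mark ''j'') (Mark ''k''))"
  define fixed where "fixed s' \<longleftrightarrow> (\<forall>a. a \<notin> {''x'', ''y'', ''l'', ''color''} \<longrightarrow> s' a = s a)" for s' :: memory
  have m: "s ''m'' 0 = m" using inv by (simp add: inv1_def darts_def)
  have marks: "halts ?marks s2 30 ?Q" if tri: "triangle s ?i ?j ?k" and s2: "fixed s2" "s2 ''color'' = ?c2" for s2
  proof -
    have "?Q (s2(''d'' := ?d))"
    proof (intro conjI)
      \<comment> \<open>The head of each dart is the tail of the next one.\<close>
      have e: "e (?id ?i) = {?u ?i, ?u ?j}" "e (?id ?j) = {?u ?j, ?u ?k}" "e (?id ?k) = {?u ?k, ?u ?i}"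
        "?id ?i < m" "?id ?j < m" "?id ?k < m"
        using inv lt tri by (auto simp: inv1_def darts_def triangle_def)
      have d: "s ''d'' (?u ?i) = 3" "s ''d'' (?u ?j) = 3" "s ''d'' (?u ?k) = 3"
        using tri by (auto simp: triangle_def)
      have cons: "consistent ?c (s ''d'')" using inv by (simp add: inv1_def)
      have "darts (s2(''d'' := ?d))"
        using inv s2 by (simp add: inv1_def darts_def fixed_def)
      then show "inv1 (s2(''d'' := ?d))"
        using triangle_step[OF cons e(4-6) e(1-3) d] s2 inv by (auto simp: inv1_def)
      show "progress s (s2(''d'' := ?d))" using s2 by (simp add: progress_def fixed_def)
      show "\<not> triangle (s2(''d'' := ?d)) ?i ?j ?k" using s2 by (simp add: triangle_def fixed_def)
    qed
    then show ?thesis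
      unfolding Mark_def
      by (intro halts_mono[OF halts_Write_Seq[OF halts_Write_Seq[OF halts_Write[where B = 5]]]])
        (use s2 in \<open>simp_all add: fixed_def\<close>)
  qed
  have merges: "halts (Seq (Merge ''i'' ''j'') (Seq (Merge ''j'' ''k'') ?marks)) s
      (merge_cost m + (merge_cost m + 30)) ?Q" if "triangle s ?i ?j ?k"
  proof (rule halts_Seq)
    show "halts (Merge ''i'' ''j'') s (merge_cost m) (\<lambda>s1. s1 ''color'' = ?c1 \<and> fixed s1)"
      by (rule halts_mono[OF halts_Merge]) (use m in \<open>simp_all add: fixed_def\<close>)
    fix s1 assume s1: "s1 ''color'' = ?c1 \<and> fixed s1"
    show "halts (Seq (Merge ''j'' ''k'') ?marks) s1 (merge_cost m + 30) ?Q"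
    proof (rule halts_Seq)
      show "halts (Merge ''j'' ''k'') s1 (merge_cost m) (\<lambda>s2. s2 ''color'' = ?c2 \<and> fixed s2)"
        by (rule halts_mono[OF halts_Merge]) (use m s1 in \<open>simp_all add: fixed_def\<close>)
    qed (use marks[OF that] in auto)
  qed
  have "halts Triangle_Step s (expr_cost ?test + 1 + (merge_cost m + (merge_cost m + 30))) ?Q"
    unfolding Triangle_Step_def
  proof (rule halts_If)
    assume "eval_expr ?test s \<noteq> 0"
    then have "\<not> triangle s ?i ?j ?k" by (auto simp: triangle_def)
    then show "halts Skip s (merge_cost m + (merge_cost m + 30)) ?Q"
      using inv by (intro halts_Skip) (simp_all add: progress_def)
  next
    assume "eval_expr ?test s = 0"
    then have "triangle s ?i ?j ?k" by (simp add: triangle_def)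
    then show "halts (Seq (Merge ''i'' ''j'') (Seq (Merge ''j'' ''k'') ?marks)) s
      (merge_cost m + (merge_cost m + 30)) ?Q" by (rule merges)
  qed
  then show ?thesis by (rule halts_mono) (auto simp: triangle_cost_def)
qed

lemma halts_Pair_Step:
  assumes inv: "inv2 b s" and lt: "s ''i'' 0 < 2 * m" "s ''j'' 0 < 2 * m"
  shows "halts Pair_Step s (pair_cost m) (\<lambda>s'. inv2 b s' \<and> progress s s' \<and>
    \<not> mergeable s' (s ''i'' 0) (s ''j'' 0))"
    (is "halts _ _ _ ?Q")
proof -
  let ?i = "s ''i'' 0" and ?j = "s ''j'' 0"
  let ?c = "s ''color''" and ?id = "s ''id''" and ?u = "s ''u''"
  let ?c1 = "relabel m (?c (?id ?i)) (?c (?id ?j)) ?c"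
  let ?d = "(s ''d'')(?u ?i := 0)"
  let ?test = "Add (Neq (Read ''u'' (Reg ''i'')) (Read ''u'' (Reg ''j'')))
    (Add (Sub (Const 1) (Neq (Read ''id'' (Reg ''i'')) (Read ''id'' (Reg ''j''))))
    (Neq (Deg ''i'') (Const 3)))"
  define fixed where "fixed s' \<longleftrightarrow> (\<forall>a. a \<notin> {''x'', ''y'', ''l'', ''color''} \<longrightarrow> s' a = s a)" for s' :: memory
  have m: "s ''m'' 0 = m" using inv by (simp add: inv2_def darts_def)
  have mark: "halts (Mark ''i'') s1 10 ?Q"
    if mer: "mergeable s ?i ?j" and s1: "fixed s1" "s1 ''color'' = ?c1" for s1
  proof -
    have "?Q (s1(''d'' := ?d))"
    proof (intro conjI)
      have "?id ?i < m" "?u ?i \<in> e (?id ?i)" "?id ?j < m" "?u ?j \<in> e (?id ?j)"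
        using inv lt by (auto simp: inv2_def darts_def)
      then have ij: "?id ?i \<in> inc (?u ?i)" "?id ?j \<in> inc (?u ?i)" "?id ?i \<noteq> ?id ?j"
        and d: "s ''d'' (?u ?i) = 3" using mer by (auto simp: inc_def mergeable_def)
      have cons: "consistent ?c (s ''d'')" using inv by (simp add: inv2_def)
      have "darts (s1(''d'' := ?d))"
        using inv s1 by (simp add: inv2_def darts_def fixed_def)
      then show "inv2 b (s1(''d'' := ?d))"
        using pair_step[OF cons ij d] s1 inv by (auto simp: inv2_def)
      show "progress s (s1(''d'' := ?d))" using s1 by (simp add: progress_def fixed_def)
      show "\<not> mergeable (s1(''d'' := ?d)) ?i ?j" using s1 by (simp add: mergeable_def fixed_def)
    qed
    then show ?thesis
      unfolding Mark_def by (intro halts_Write) (use s1 in \<open>simp_all add: fixed_def\<close>)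
  qed
  have merges: "halts (Seq (Merge ''i'' ''j'') (Mark ''i'')) s (merge_cost m + 10) ?Q" if "mergeable s ?i ?j"
  proof (rule halts_Seq)
    show "halts (Merge ''i'' ''j'') s (merge_cost m) (\<lambda>s1. s1 ''color'' = ?c1 \<and> fixed s1)"
      by (rule halts_mono[OF halts_Merge]) (use m in \<open>simp_all add: fixed_def\<close>)
  qed (use mark[OF that] in auto)
  have "halts Pair_Step s (expr_cost ?test + 1 + (merge_cost m + 10)) ?Q"
    unfolding Pair_Step_def
  proof (rule halts_If)
    assume "eval_expr ?test s \<noteq> 0"
    then have "\<not> mergeable s ?i ?j"
      by (auto simp: mergeable_def Neq_def)
    then show "halts Skip s (merge_cost m + 10) ?Q"
      using inv by (intro halts_Skip) (simp_all add: progress_def)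
  next
    assume "eval_expr ?test s = 0"
    then have "mergeable s ?i ?j" by (auto simp: mergeable_def Neq_def)
    then show "halts (Seq (Merge ''i'' ''j'') (Mark ''i'')) s (merge_cost m + 10) ?Q"
      by (rule merges)
  qed
  then show ?thesis by (rule halts_mono) (auto simp: pair_cost_def)
qed

lemma halts_triangle_loop:
  assumes "inv1 s"
  shows "halts (For ''i'' ''M'' (For ''j'' ''M'' (For ''k'' ''M'' Triangle_Step))) s
    (for_cost (2 * m) (for_cost (2 * m) (for_cost (2 * m) (triangle_cost m))))
    (\<lambda>s'. inv1 s' \<and> (\<forall>i<2 * m. \<forall>j<2 * m. \<forall>k<2 * m. \<not> triangle s' i j k))"
proof -
  \<comment> \<open>Together the three invariants exclude all lexicographically earlier triples. The
    inner ones also fix the outer counters, which the inner loops leave alone.\<close>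
  define I1 where "I1 i s \<longleftrightarrow> inv1 s \<and> (\<forall>i'<i. \<forall>j<2 * m. \<forall>k<2 * m. \<not> triangle s i' j k)" for i s
  define I2 where "I2 i j s \<longleftrightarrow> I1 i s \<and> s ''i'' 0 = i \<and> (\<forall>j'<j. \<forall>k<2 * m. \<not> triangle s i j' k)" for i j s
  define I3 where "I3 i j k s \<longleftrightarrow> I2 i j s \<and> s ''j'' 0 = j \<and> (\<forall>k'<k. \<not> triangle s i j k')" for i j k s
  have M: "s ''M'' 0 = 2 * m" if "inv1 s" for s using that by (simp add: inv1_def darts_def)
  have body3: "halts Triangle_Step s (triangle_cost m) (I3 i j (Suc k))"
    if "i < 2 * m" "j < 2 * m" "k < 2 * m" "s ''k'' 0 = k" "I3 i j k s" for i j k s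
  proof (rule halts_mono[OF halts_Triangle_Step])
    fix s' assume *: "inv1 s' \<and> progress s s' \<and> \<not> triangle s' (s ''i'' 0) (s ''j'' 0) (s ''k'' 0)"
    then have "s' ''i'' = s ''i''" "s' ''j'' = s ''j''" "\<And>a b c. \<not> triangle s a b c \<Longrightarrow> \<not> triangle s' a b c"
      using progress_registers progress_triangle by blast+
    then show "I3 i j (Suc k) s'"
      using that * by (simp add: I1_def I2_def I3_def less_Suc_eq)
  qed (use that in \<open>auto simp: I1_def I2_def I3_def\<close>)
  have body2: "halts (For ''k'' ''M'' Triangle_Step) s (for_cost (2 * m) (triangle_cost m)) (I2 i (Suc j))"
    if "i < 2 * m" "j < 2 * m" "s ''j'' 0 = j" "I2 i j s" for i j s
  proof (rule halts_mono[OF halts_For[where I = "I3 i j" and N = "2 * m"]])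
    fix x s v assume "I3 i j x s"
    then show "I3 i j x (s(''k'' := v))" by (simp add: I1_def I2_def I3_def)
  next
    fix x s assume "x < 2 * m" "s ''k'' 0 = x" "I3 i j x s"
    then show "halts Triangle_Step s (triangle_cost m) (I3 i j (Suc x))" using that body3 by blast
  qed (use that M in \<open>auto simp: I1_def I2_def I3_def less_Suc_eq\<close>)
  have body1: "halts (For ''j'' ''M'' (For ''k'' ''M'' Triangle_Step)) s
      (for_cost (2 * m) (for_cost (2 * m) (triangle_cost m))) (I1 (Suc i))"
    if "i < 2 * m" "s ''i'' 0 = i" "I1 i s" for i s
  proof (rule halts_mono[OF halts_For[where I = "I2 i" and N = "2 * m"]])
    fix x s v assume "I2 i x s"
    then show "I2 i x (s(''j'' := v))" by (simp add: I1_def I2_def)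
  next
    fix x s assume "x < 2 * m" "s ''j'' 0 = x" "I2 i x s"
    then show "halts (For ''k'' ''M'' Triangle_Step) s (for_cost (2 * m) (triangle_cost m)) (I2 i (Suc x))" using that body2 by blast
  qed (use that M in \<open>auto simp: I1_def I2_def less_Suc_eq\<close>)
  show ?thesis
  proof (rule halts_mono[OF halts_For[where I = "I1" and N = "2 * m"]])
    fix x s v assume "I1 x s"
    then show "I1 x (s(''i'' := v))" by (simp add: I1_def)
  next
    fix x s assume "x < 2 * m" "s ''i'' 0 = x" "I1 x s"
    then show "halts (For ''j'' ''M'' (For ''k'' ''M'' Triangle_Step)) s (for_cost (2 * m) (for_cost (2 * m) (triangle_cost m))) (I1 (Suc x))" using body1 by blast
  qed (use assms M in \<open>auto simp: I1_def less_Suc_eq\<close>)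
qed

lemma halts_pair_loop:
  assumes "inv2 b s"
  shows "halts (For ''i'' ''M'' (For ''j'' ''M'' Pair_Step)) s
    (for_cost (2 * m) (for_cost (2 * m) (pair_cost m)))
    (\<lambda>s'. inv2 b s' \<and> (\<forall>i<2 * m. \<forall>j<2 * m. \<not> mergeable s' i j))"
proof -
  define I1 where "I1 i s \<longleftrightarrow> inv2 b s \<and> (\<forall>i'<i. \<forall>j<2 * m. \<not> mergeable s i' j)" for i s
  define I2 where "I2 i j s \<longleftrightarrow> I1 i s \<and> s ''i'' 0 = i \<and> (\<forall>j'<j. \<not> mergeable s i j')" for i j s
  have M: "s ''M'' 0 = 2 * m" if "inv2 b s" for s using that by (simp add: inv2_def darts_def)
  have body2: "halts Pair_Step s (pair_cost m) (I2 i (Suc j))"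
    if "i < 2 * m" "j < 2 * m" "s ''j'' 0 = j" "I2 i j s" for i j s
  proof (rule halts_mono[OF halts_Pair_Step])
    fix s' assume *: "inv2 b s' \<and> progress s s' \<and> \<not> mergeable s' (s ''i'' 0) (s ''j'' 0)"
    then have "s' ''i'' = s ''i''" "\<And>a b. \<not> mergeable s a b \<Longrightarrow> \<not> mergeable s' a b"
      using progress_registers progress_mergeable by blast+
    then show "I2 i (Suc j) s'"
      using that * by (simp add: I1_def I2_def less_Suc_eq)
  qed (use that in \<open>auto simp: I1_def I2_def\<close>)
  have body1: "halts (For ''j'' ''M'' Pair_Step) s (for_cost (2 * m) (pair_cost m)) (I1 (Suc i))"
    if "i < 2 * m" "s ''i'' 0 = i" "I1 i s" for i s
  proof (rule halts_mono[OF halts_For[where I = "I2 i" and N = "2 * m"]])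
    fix x s v assume "I2 i x s"
    then show "I2 i x (s(''j'' := v))" by (simp add: I1_def I2_def)
  next
    fix x s assume "x < 2 * m" "s ''j'' 0 = x" "I2 i x s"
    then show "halts Pair_Step s (pair_cost m) (I2 i (Suc x))" using that body2 by blast
  qed (use that M in \<open>auto simp: I1_def I2_def less_Suc_eq\<close>)
  show ?thesis
  proof (rule halts_mono[OF halts_For[where I = "I1" and N = "2 * m"]])
    fix x s v assume "I1 x s"
    then show "I1 x (s(''i'' := v))" by (simp add: I1_def)
  next
    fix x s assume "x < 2 * m" "s ''i'' 0 = x" "I1 x s"
    then show "halts (For ''j'' ''M'' Pair_Step) s (for_cost (2 * m) (pair_cost m)) (I1 (Suc x))" using body1 by blast
  qed (use assms M in \<open>auto simp: I1_def less_Suc_eq\<close>)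
qed

text \<open>Maximality of the greedy choice: some orientation of the triangle was tested and
  rejected, so one corner no longer has entry 3. By consistency it is finished.\<close>

lemma finished_meets_triangle:
  assumes inv: "inv1 s" and tri: "\<forall>i<2 * m. \<forall>j<2 * m. \<forall>k<2 * m. \<not> triangle s i j k"
    and pqr: "p \<in> cubic" "q \<in> cubic" "r \<in> cubic" "p \<noteq> q" "q \<noteq> r" "r \<noteq> p"
    and edges: "{p, q} \<in> e ` {..<m}" "{q, r} \<in> e ` {..<m}" "{r, p} \<in> e ` {..<m}"
  shows "{p, q, r} \<inter> finished (s ''d'') \<noteq> {}"
proof -
  have dart: "\<exists>i<2 * m. s ''u'' i = x \<and> s ''v'' i = y" if xy: "{x, y} \<in> e ` {..<m}" "x \<noteq> y" for x y
  proof -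
    obtain l where l: "l < m" "e l = {x, y}" using xy by auto
    then obtain i where i: "i < 2 * m" "s ''u'' i = x" "s ''id'' i = l"
      using inv unfolding inv1_def darts_def by blast
    then have "{x, y} = {x, s ''v'' i}" using inv l unfolding inv1_def darts_def by metis
    then have "s ''v'' i = y" using xy by (auto simp: doubleton_eq_iff)
    then show ?thesis using i by blast
  qed
  obtain i j k where "i < 2 * m" "s ''u'' i = p" "s ''v'' i = q" "j < 2 * m" "s ''u'' j = q" "s ''v'' j = r"
    "k < 2 * m" "s ''u'' k = r" "s ''v'' k = p"
    using dart[OF edges(1)] dart[OF edges(2)] dart[OF edges(3)] pqr by metis
  then have "\<not> (s ''d'' p = 3 \<and> s ''d'' q = 3 \<and> s ''d'' r = 3)"
    using tri[rule_format, of i j k] by (auto simp: triangle_def)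
  moreover have "s ''d'' w = 3 \<or> w \<in> finished (s ''d'')" if "w \<in> cubic" for w
  proof -
    have "consistent (s ''color'') (s ''d'')" using inv by (simp add: inv1_def)
    from this[unfolded consistent_def, rule_format, of w] show ?thesis
      using that by (auto simp: cubic_def finished_def)
  qed
  ultimately show ?thesis using pqr by blast
qed

text \<open>An entry 3 at \<open>w\<close> would leave two edges at \<open>w\<close> whose darts
  form a mergeable pair. Vertices of smaller degree see at most two colors anyway.\<close>

lemma pair_loop_final:
  assumes inv: "inv2 b s" and mer: "\<forall>i<2 * m. \<forall>j<2 * m. \<not> mergeable s i j"
  shows "finished (s ''d'') = cubic" and "card (s ''color'' ` inc w) \<le> 2"
proof -
  have cons: "consistent (s ''color'') (s ''d'')" using inv by (simp add: inv2_def)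
  have not3: "s ''d'' w \<noteq> 3" for w
  proof
    assume d: "s ''d'' w = 3"
    then have "card (inc w) = 3" using consistent_cubic[OF cons] by (simp add: cubic_def)
    then obtain l1 l2 where l: "l1 \<in> inc w" "l2 \<in> inc w" "l1 \<noteq> l2"
      by (auto simp: numeral_eq_Suc card_Suc_eq)
    have "\<exists>i<2 * m. s ''u'' i = w \<and> s ''id'' i = l" if "l \<in> inc w" for l
      using inv that by (simp add: inv2_def darts_def inc_def)
    then obtain i j where "i < 2 * m" "s ''u'' i = w" "s ''id'' i = l1" "j < 2 * m" "s ''u'' j = w" "s ''id'' j = l2"
      using l by metis
    then have "mergeable s i j" using l d by (simp add: mergeable_def)
    then show False using mer \<open>i < 2 * m\<close> \<open>j < 2 * m\<close> by blast
  qed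
  have "s ''d'' w = 0" if "w \<in> cubic" for w
    using not3[of w] that cons[unfolded consistent_def, rule_format, of w] by (auto simp: cubic_def)
  then show "finished (s ''d'') = cubic" by (auto simp: finished_def)
  show "card (s ''color'' ` inc w) \<le> 2"
  proof (cases "w \<in> cubic")
    case True
    then show ?thesis
      using not3[of w] cons[unfolded consistent_def, rule_format, of w] by (auto simp: cubic_def)
  next
    case False
    then have "card (inc w) \<le> 2" using deg_le[of w] by (simp add: cubic_def inc_def)
    then show ?thesis using card_image_le[OF finite_inc] le_trans by blast
  qed
qed

end

section \<open>Initialisation\<close>

definition init_inv :: "(nat \<times> nat) list \<Rightarrow> nat \<Rightarrow> memory \<Rightarrow> bool" where
  "init_inv es k s \<longleftrightarrow> s ''m'' 0 = length es \<and>
    (\<forall>l<length es. s ''u'' l = fst (es ! l) \<and> s ''v'' l = snd (es ! l)) \<and>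
    (\<forall>l<k. s ''u'' (length es + l) = snd (es ! l) \<and> s ''v'' (length es + l) = fst (es ! l) \<and>
      s ''id'' l = l \<and> s ''id'' (length es + l) = l \<and> s ''color'' l = l) \<and>
    (\<forall>w. s ''d'' w = card {l. l < k \<and> w \<in> endpoints (es ! l)})"

lemma halts_Init_Step:
  assumes k: "k < length es" "s ''i'' 0 = k" "init_inv es k s"
    and loopfree: "fst (es ! k) \<noteq> snd (es ! k)"
  shows "halts Init_Step s 100 (init_inv es (Suc k))"
proof -
  let ?m = "length es"
  \<comment> \<open>The fact \<open>es \<noteq> []\<close> keeps the cells \<open>k\<close> and
    \<open>?m + k\<close> apart, so extending \<open>u\<close> does not destroy the value read
    next.\<close>
  have *: "es \<noteq> []" "s ''m'' 0 = ?m" "s ''u'' k = fst (es ! k)" "s ''v'' k = snd (es ! k)"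
    using k by (auto simp: init_inv_def)
  define s' where "s' = s(''u'' := (s ''u'')(?m + k := snd (es ! k)), ''v'' := (s ''v'')(?m + k := fst (es ! k)),
    ''id'' := (s ''id'')(k := k, ?m + k := k), ''color'' := (s ''color'')(k := k),
    ''d'' := (s ''d'')(fst (es ! k) := s ''d'' (fst (es ! k)) + 1, snd (es ! k) := s ''d'' (snd (es ! k)) + 1))"
  have d: "s' ''d'' w = card {l. l < Suc k \<and> w \<in> endpoints (es ! l)}" for w
  proof -
    \<comment> \<open>As the edge is not a loop, the two increments hit different cells.\<close>
    have "s' ''d'' w = card {l. l < k \<and> w \<in> endpoints (es ! l)} + (if w \<in> endpoints (es ! k) then 1 else 0)"
      using k loopfree by (simp add: s'_def init_inv_def endpoints_def)
    also have "\<dots> = card {l. l < Suc k \<and> w \<in> endpoints (es ! l)}"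
    proof (cases "w \<in> endpoints (es ! k)")
      case True
      then have "{l. l < Suc k \<and> w \<in> endpoints (es ! l)} = insert k {l. l < k \<and> w \<in> endpoints (es ! l)}"
        by (auto simp: less_Suc_eq)
      then show ?thesis using True by simp
    next
      case False
      then have "{l. l < Suc k \<and> w \<in> endpoints (es ! l)} = {l. l < k \<and> w \<in> endpoints (es ! l)}"
        by (auto simp: less_Suc_eq)
      then show ?thesis using False by simp
    qed
    finally show ?thesis .
  qed
  have post: "init_inv es (Suc k) s'"
    unfolding init_inv_def using k d by (auto simp: s'_def init_inv_def less_Suc_eq)
  show ?thesis
    unfolding Init_Step_def
    by (rule halts_mono, (rule halts_Write_Seq)+, rule halts_Write[where B = 20 and Q = "\<lambda>t. t = s'"])
      (use * k loopfree post in \<open>simp_all add: s'_def fun_upd_twist\<close>)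
qed

definition total_cost :: "nat \<Rightarrow> nat" where
  "total_cost m = for_cost m 100 + 9 +
    (for_cost (2 * m) (for_cost (2 * m) (for_cost (2 * m) (triangle_cost m))) +
     for_cost (2 * m) (for_cost (2 * m) (pair_cost m)))"

section \<open>Correctness of the program on an input graph\<close>

context
  fixes n :: nat and E :: "nat set set" and es :: "(nat \<times> nat) list"
  assumes G: "simple_graph {..<n} E" "subcubic {..<n} E" "edge_list E es"
begin

abbreviation edge :: "nat \<Rightarrow> nat set" where
  "edge l \<equiv> endpoints (es ! l)"

lemma edges_eq: "E = edge ` {..<length es}"
proof -
  have "set es = (!) es ` {..<length es}" by (auto simp: set_conv_nth)
  then show ?thesis using G(3) by (simp add: edge_list_def image_image)
qed

lemma inj_edge: "inj_on edge {..<length es}"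
  using G(3) by (auto simp: edge_list_def distinct_conv_nth inj_on_def)

lemma incident_edges_eq: "incident_edges E w = edge ` {l. l < length es \<and> w \<in> edge l}"
  by (auto simp: incident_edges_def edges_eq)

lemma card_incident_edges: "card (incident_edges E w) = card {l. l < length es \<and> w \<in> edge l}"
  unfolding incident_edges_eq by (intro card_image inj_on_subset[OF inj_edge]) auto

lemma subcubic_edges: "subcubic_edges edge (length es)"
proof
  show "card (edge l) = 2" if "l < length es" for l
    using G(1) that by (simp add: edges_eq simple_graph_def)
  show "inj_on edge {..<length es}" by (rule inj_edge)
  show "card {l. l < length es \<and> w \<in> edge l} \<le> 3" for w
  \<comment> \<open>The locale bounds the degree of every natural number; those outside the vertex
    set lie on no edge.\<close>
  proof (cases "w < n")
    case True
    then show ?thesis using G(2) by (simp add: subcubic_def card_incident_edges)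
  next
    case False
    then have "incident_edges E w = {}" using G(1) by (auto simp: incident_edges_def simple_graph_def)
    then show ?thesis unfolding card_incident_edges[symmetric] by simp
  qed
qed

interpretation subcubic_edges edge "length es"
  by (rule subcubic_edges)

lemma halts_Init:
  "halts Init (input_memory n es) (for_cost (length es) 100 + 9) inv1"
proof -
  let ?m = "length es"
  have "halts (For ''i'' ''m'' Init_Step) (input_memory n es) (for_cost ?m 100) (init_inv es ?m)"
  proof (rule halts_For)
    fix k s assume k: "k < ?m" "s ''i'' 0 = k" "init_inv es k s"
    have "fst (es ! k) \<noteq> snd (es ! k)" using card_edge[OF k(1)] by (auto simp: endpoints_def)
    then show "halts Init_Step s 100 (init_inv es (Suc k))" using halts_Init_Step k by blast
  qed (auto simp: init_inv_def input_memory_def)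
  then show ?thesis
    unfolding Init_def
  proof (rule halts_Seq)
    fix s assume s: "init_inv es ?m s"
    let ?s = "s(''M'' := (s ''M'')(0 := 2 * ?m))"
    have "darts ?s"
      unfolding darts_def
    proof (intro conjI allI impI ballI)
      show "?s ''m'' 0 = ?m" "?s ''M'' 0 = 2 * ?m" using s by (simp_all add: init_inv_def)
      fix i assume i: "i < 2 * ?m"
      show "?s ''id'' i < ?m" "edge (?s ''id'' i) = {?s ''u'' i, ?s ''v'' i}"
      proof (atomize (full), cases "i < ?m")
        case False
        then obtain l where "i = ?m + l" "l < ?m" using i by (metis add_less_cancel_left le_Suc_ex mult_2 not_le)
        then show "?s ''id'' i < ?m \<and> edge (?s ''id'' i) = {?s ''u'' i, ?s ''v'' i}"
          using s by (auto simp: init_inv_def endpoints_def)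
      qed (use s in \<open>auto simp: init_inv_def endpoints_def\<close>)
    next
      fix l w assume l: "l < ?m" "w \<in> edge l"
      then have "s ''u'' l = w \<and> s ''id'' l = l \<or> s ''u'' (?m + l) = w \<and> s ''id'' (?m + l) = l"
        using s by (auto simp: init_inv_def endpoints_def)
      moreover have "l < 2 * ?m" "?m + l < 2 * ?m" using l by auto
      ultimately have "\<exists>i<2 * ?m. s ''u'' i = w \<and> s ''id'' i = l" by blast
      then show "\<exists>i<2 * ?m. ?s ''u'' i = w \<and> ?s ''id'' i = l" by simp
    qed
    moreover have "s ''color'' ` {..<?m} = {..<?m}" using s by (simp add: init_inv_def)
    moreover have "consistent (s ''color'') (s ''d'')" using s by (simp add: init_inv_def consistent_def inc_def)
    ultimately have "inv1 ?s" by (simp add: inv1_def)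
    then show "halts (Write ''M'' (Const 0) (Add (Reg ''m'') (Reg ''m''))) s 9 inv1"
      using s by (intro halts_Write) (simp_all add: init_inv_def mult_2)
  qed
qed

text \<open>The witness \<open>D\<close> is the set of vertices finished by the triangle pass,
  recorded before the pair pass extends it to all of \<open>cubic\<close>.\<close>

lemma halts_Color_Subcubic:
  "halts Color_Subcubic (input_memory n es) (total_cost (length es)) (\<lambda>s. \<exists>D.
    finite D \<and> 3 * length es + card D \<le> 3 * card (s ''color'' ` {..<length es}) + 3 * card cubic \<and>
    (\<forall>w. card (s ''color'' ` inc w) \<le> 2) \<and>
    (\<forall>p q r. {p, q, r} \<subseteq> cubic \<longrightarrow> card {p, q, r} = 3 \<longrightarrow> {p, q} \<in> E \<longrightarrow> {q, r} \<in> E \<longrightarrow> {r, p} \<in> E \<longrightarrow>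
      {p, q, r} \<inter> D \<noteq> {}))"
    (is "halts _ _ _ ?Q")
  unfolding Color_Subcubic_def total_cost_def
proof (rule halts_Seq[OF halts_Init], rule halts_Seq[OF halts_triangle_loop])
  fix s assume s: "inv1 s \<and> (\<forall>i<2 * length es. \<forall>j<2 * length es. \<forall>k<2 * length es. \<not> triangle s i j k)"
  let ?D = "finished (s ''d'')"
  have hit: "{p, q, r} \<inter> ?D \<noteq> {}"
    if "{p, q, r} \<subseteq> cubic" "card {p, q, r} = 3" "{p, q} \<in> E" "{q, r} \<in> E" "{r, p} \<in> E" for p q r
    using s that by (intro finished_meets_triangle) (auto simp: edges_eq card_insert_if split: if_splits)
  show "halts (For ''i'' ''M'' (For ''j'' ''M'' Pair_Step)) s
      (for_cost (2 * length es) (for_cost (2 * length es) (pair_cost (length es)))) ?Q"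
  proof (rule halts_mono[OF halts_pair_loop[of "card ?D"] order_refl])
    \<comment> \<open>Add \<open>card ?D\<close> to both sides of the inequality in
      \<open>inv1\<close>.\<close>
    show "inv2 (card ?D) s" using s by (auto simp: inv1_def inv2_def)
    fix s' assume "inv2 (card ?D) s' \<and> (\<forall>i<2 * length es. \<forall>j<2 * length es. \<not> mergeable s' i j)"
    then have s': "inv2 (card ?D) s'" "\<forall>i<2 * length es. \<forall>j<2 * length es. \<not> mergeable s' i j"
      by blast+
    then have "3 * length es + card ?D \<le> 3 * card (s' ''color'' ` {..<length es}) + 3 * card cubic"
      using pair_loop_final(1)[OF s'] by (simp add: inv2_def)
    then show "?Q s'" using pair_loop_final(2)[OF s'] hit by (intro exI[of _ ?D]) simp
  qed
qed

lemma final_coloring: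
  assumes D: "finite D" "3 * length es + card D \<le> 3 * card (c ` {..<length es}) + 3 * card cubic"
      "\<And>w. card (c ` inc w) \<le> 2"
      "\<And>p q r. {p, q, r} \<subseteq> cubic \<Longrightarrow> card {p, q, r} = 3 \<Longrightarrow> {p, q} \<in> E \<Longrightarrow> {q, r} \<in> E \<Longrightarrow> {r, p} \<in> E \<Longrightarrow>
        {p, q, r} \<inter> D \<noteq> {}"
  shows "\<exists>\<chi>. (\<forall>l<length es. \<chi> (edge l) = c l) \<and> edge_2_coloring {..<n} E \<chi> \<and>
    2 * opt {..<n} E \<le> 3 * num_colors E \<chi>"
proof (intro exI conjI allI impI)
  let ?m = "length es"
  \<comment> \<open>The color array is indexed by list positions, so an edge is first sent back to
    its position.\<close>
  let ?\<chi> = "\<lambda>A. c (the_inv_into {..<?m} edge A)"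
  show eq: "?\<chi> (edge l) = c l" if "l < ?m" for l
    using that by (simp add: the_inv_into_f_f[OF inj_edge])
  have im: "?\<chi> ` edge ` A = c ` A" if "A \<subseteq> {..<?m}" for A
    unfolding image_image using that eq by (intro image_cong) auto
  show "edge_2_coloring {..<n} E ?\<chi>"
    using D(3) im[OF inc_subset] by (simp add: edge_2_coloring_def incident_edges_eq flip: inc_def)
  have num: "num_colors E ?\<chi> = card (c ` {..<?m})"
    unfolding num_colors_def edges_eq using im[of "{..<?m}"] by simp
  have cub: "cubic = {v \<in> {..<n}. card (incident_edges E v) = 3}"
  proof -
    have "w < n" if "card (incident_edges E w) = 3" for w
    proof -
      have "incident_edges E w \<noteq> {}" using that by auto
      then show ?thesis using G(1) by (auto simp: incident_edges_def simple_graph_def)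
    qed
    then show ?thesis by (auto simp: cubic_def inc_def card_incident_edges)
  qed
  have m: "card E = ?m" unfolding edges_eq by (simp add: card_image inj_edge)
  have "opt {..<n} E \<in> {num_colors E \<chi> | \<chi>. edge_2_coloring {..<n} E \<chi>}"
    unfolding opt_def by (intro Max_in finite_num_colors G num_colors_nonempty)
  then obtain \<chi> where "edge_2_coloring {..<n} E \<chi>" and opt: "opt {..<n} E = num_colors E \<chi>" by blast
  then have "4 * num_colors E \<chi> + 3 * card cubic \<le> 4 * ?m + card D"
    using num_colors_upper_bound[OF G(1,2) _ cub D(1,4)] m by simp
  moreover have "3 * card cubic \<le> 2 * ?m"
    using three_card_cubic_le[OF G(1)] by (simp add: cub m)
  \<comment> \<open>Twice the lower bound on 3 \<open>num_colors\<close> exceeds the upper bound on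
    4 \<open>opt\<close> by 2m + |D| - 3 |cubic|, which is nonnegative by the degree sum.\<close>
  ultimately show "2 * opt {..<n} E \<le> 3 * num_colors E ?\<chi>"
    using D(2) unfolding num opt by linarith
qed

end

section \<open>Polynomial time bound and conclusion\<close>

lemma total_cost_poly: "\<exists>p. \<forall>m. total_cost m \<le> poly p m"
proof -
  \<comment> \<open>The witness repeats the cost definitions over polynomials, with
    \<open>?f\<close> for \<open>for_cost\<close> and \<open>?X\<close> for the variable.\<close>
  let ?f = "\<lambda>(N :: nat poly) B. N * (B + 12) + 9"
  let ?X = "[:0, 1:] :: nat poly"
  let ?merge = "12 + ?f ?X 20"
  let ?p = "?f ?X 100 + 9 + (?f (2 * ?X) (?f (2 * ?X) (?f (2 * ?X) (2 * ?merge + 150))) +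
    ?f (2 * ?X) (?f (2 * ?X) (?merge + 100)))"
  have "total_cost m \<le> poly ?p m" for m
    by (simp add: total_cost_def for_cost_def triangle_cost_def pair_cost_def merge_cost_def algebra_simps)
  then show ?thesis by blast
qed

lemma total_cost_mono: "m \<le> m' \<Longrightarrow> total_cost m \<le> total_cost m'"
  unfolding total_cost_def for_cost_def triangle_cost_def pair_cost_def merge_cost_def
  by (intro add_mono mult_le_mono order_refl)

theorem theorem1:
  "\<exists>(c :: prog) (p :: nat poly). \<forall>(n :: nat) (E :: nat set set) (es :: (nat \<times> nat) list).
     simple_graph {..<n} E \<and> subcubic {..<n} E \<and> edge_list E es \<longrightarrow>
     (\<exists>(t :: nat) (s :: memory) (\<chi> :: nat set \<Rightarrow> nat).
        runs c (input_memory n es) t s \<and>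
        t \<le> poly p (n + length es) \<and>
        outputs_coloring es s \<chi> \<and>
        edge_2_coloring {..<n} E \<chi> \<and>
        real (num_colors E \<chi>) \<ge> real (opt {..<n} E) / 1.5)"
proof -
  obtain p where p: "\<And>m. total_cost m \<le> poly p m" using total_cost_poly by blast
  show ?thesis
  proof (intro exI[of _ Color_Subcubic] exI[of _ p] allI impI, elim conjE)
    fix n E es assume G: "simple_graph {..<n} E" "subcubic {..<n} E" "edge_list E es"
    obtain t s D where ts: "runs Color_Subcubic (input_memory n es) t s" "t \<le> total_cost (length es)"
      and D: "finite D"
        "3 * length es + card D \<le> 3 * card (s ''color'' ` {..<length es}) +
          3 * card (subcubic_edges.cubic (\<lambda>l. endpoints (es ! l)) (length es))"
        "\<And>w. card (s ''color'' ` subcubic_edges.inc (\<lambda>l. endpoints (es ! l)) (length es) w) \<le> 2"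
        "\<And>p q r. {p, q, r} \<subseteq> subcubic_edges.cubic (\<lambda>l. endpoints (es ! l)) (length es) \<Longrightarrow>
          card {p, q, r} = 3 \<Longrightarrow> {p, q} \<in> E \<Longrightarrow> {q, r} \<in> E \<Longrightarrow> {r, p} \<in> E \<Longrightarrow> {p, q, r} \<inter> D \<noteq> {}"
      using halts_Color_Subcubic[OF G] unfolding halts_def by blast
    obtain \<chi> where \<chi>: "\<forall>l<length es. \<chi> (endpoints (es ! l)) = s ''color'' l"
      "edge_2_coloring {..<n} E \<chi>" "2 * opt {..<n} E \<le> 3 * num_colors E \<chi>"
      using final_coloring[OF G D] by blast
    \<comment> \<open>The cost depends only on the number of edges and is monotone, so it may be
      evaluated at the larger input size.\<close>
    have "t \<le> poly p (n + length es)"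
      using ts(2) total_cost_mono[of "length es" "n + length es"] p[of "n + length es"] by linarith
    moreover have "real (num_colors E \<chi>) \<ge> real (opt {..<n} E) / 1.5"
      using \<chi>(3) by simp
    ultimately show "\<exists>t s \<chi>. runs Color_Subcubic (input_memory n es) t s \<and> t \<le> poly p (n + length es) \<and>
        outputs_coloring es s \<chi> \<and> edge_2_coloring {..<n} E \<chi> \<and>
        real (num_colors E \<chi>) \<ge> real (opt {..<n} E) / 1.5"
      using ts(1) \<chi> unfolding outputs_coloring_def by blast
  qed
qed

end
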